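(* Let $d \geq 2$ be a fixed integer. Let $p$ be a prime such that $p \equiv 1 \pmod d$, and let $\omega \in \mathbb{F}_p^*$ be a primitive $d$-th root of unity. Let $A \subset \{1, 2, \dots, p-1\}$ be a set of representatives forming a fundamental domain for the multiplication action of the group $G_d = \{1, \omega, \dots, \omega^{d-1}\}$ on $\mathbb{F}_p^*$, meaning that $|A| = \frac{p-1}{d}$ and, identifying the elements of $A$ with their residue classes modulo $p$, $\mathbb{F}_p^* = \bigsqcup_{i=0}^{d-1} \omega^i A$ (disjoint union). Then the counting function $$f_A(p) := \#\left\{x \in A : \left\{ \frac{x^d}{p} \right\} > \frac{1}{2} \right\}$$ satisfies $$\left|f_A(p)-\frac{(p-1)^2}{2dp}\right|\leq\frac{4}{d\pi^2}\left((d-1)\sqrt{p}+1\right)\log(3p).$$ In particular, $$f_A(p)=\frac{p}{2d}+O_d(\sqrt{p}\log p).$$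
   Context: $\{t\}$ denotes the fractional part of a real number $t$; $\mathbb F_p^*$ is the multiplicative group of the field with $p$ elements; $\log$ is the natural logarithm. $F = O_d(G)$ means $|F|\le cG$ for a constant $c>0$ depending only on $d$ (not on $p$, $\omega$ or $A$). *)

theory Defs
  imports Complex_Main "HOL-Number_Theory.Number_Theory" "HOL-Algebra.Coset" "HOL-Library.Disjoint_Sets"
begin

text \<open>
  The field with \<open>p\<close> elements is \<^term>\<open>residue_ring (int p)\<close>, whose carrier is the
  set of integers \<open>{0..p-1}\<close>. Hence a subset of \<open>{1..p-1}\<close> is at the same time a set of
  integers and a set of residue classes, and no conversion between the two is needed.
\<close>

abbreviation GFp :: "nat \<Rightarrow> int ring" where
  "GFp p \<equiv> residue_ring (int p)"

definition primitive_root_of_unity :: "('a, 'm) monoid_scheme \<Rightarrow> nat \<Rightarrow> 'a \<Rightarrow> bool" where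
  "primitive_root_of_unity R d w \<longleftrightarrow>
     w \<in> carrier R \<and> w [^]\<^bsub>R\<^esub> d = \<one>\<^bsub>R\<^esub> \<and>
     (\<forall>k::nat. 0 < k \<and> k < d \<longrightarrow> w [^]\<^bsub>R\<^esub> k \<noteq> \<one>\<^bsub>R\<^esub>)"

text \<open>The left coset notation \<open>a <# A\<close> is used for the translate \<open>aA = {a x | x \<in> A}\<close>,
  also when \<open>A\<close> is not a subgroup.\<close>

definition fundamental_domain :: "nat \<Rightarrow> nat \<Rightarrow> int \<Rightarrow> int set \<Rightarrow> bool" where
  "fundamental_domain p d w A \<longleftrightarrow>
     A \<subseteq> {1..int p - 1} \<and>
     real (card A) = (real p - 1) / real d \<and>
     Units (GFp p) = (\<Union>i<d. (w [^]\<^bsub>GFp p\<^esub> i) <#\<^bsub>GFp p\<^esub> A) \<and>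
     disjoint_family_on (\<lambda>i. (w [^]\<^bsub>GFp p\<^esub> i) <#\<^bsub>GFp p\<^esub> A) {..<d}"

definition upper_half_count :: "nat \<Rightarrow> int set \<Rightarrow> nat \<Rightarrow> nat" where
  "upper_half_count d A p = card {x \<in> A. frac (real_of_int (x ^ d) / real p) > 1 / 2}"

end

theory Submission
  imports Defs "HOL-Analysis.Analysis"
begin

text \<open>
  Since \<open>\<omega>\<^sup>d = 1\<close>, the residue of \<open>x\<^sup>d\<close> modulo \<open>p\<close> is constant on the orbits of \<open>G\<^sub>d\<close>, so
  \<open>d \<cdot> f\<^sub>A(p)\<close> is the number \<open>N\<close> of all \<open>x \<in> {1..p-1}\<close> whose \<open>d\<close>-th power falls into the
  upper half interval \<open>H = {(p+1)/2..p-1}\<close>, whatever \<open>A\<close> is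
  (\<open>card_invariant_on_fundamental_domain\<close>). Detecting \<open>x\<^sup>d \<equiv> h\<close> by additive characters \<open>e\<close> gives
  \<open>p N = \<Sum>\<^sub>k S'(k) \<cdot> cnj (H'(k))\<close> with \<open>S'(k) = \<Sum>\<^sub>x e(k x\<^sup>d)\<close>, \<open>x \<noteq> 0\<close>, and
  \<open>H'(k) = \<Sum>\<^sub>h e(k h)\<close>. The frequency \<open>k = 0\<close> contributes the main term \<open>(p-1)\<^sup>2/2\<close>; the rest
  is bounded by the product of two estimates.

  The first one is \<open>\<bar>S(k)\<bar> \<le> (d-1) \<surd>p\<close> for the complete sum \<open>S(k) = S'(k) + 1\<close> and \<open>k \<noteq> 0\<close>
  (\<open>norm_power_sum_le\<close>). By orthogonality, \<open>\<Sum> S(k) = 0\<close> and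
  \<open>\<Sum> \<bar>S(k)\<bar>\<^sup>2 \<le> p (p-1) (d-1)\<close> over \<open>k \<noteq> 0\<close>, because \<open>y\<^sup>d \<equiv> x\<^sup>d\<close> has at most \<open>d\<close> solutions
  \<open>y\<close>. Moreover \<open>S\<close> is constant on the coset of \<open>k\<close> modulo \<open>d\<close>-th powers, which contains at least
  \<open>(p-1)/d\<close> frequencies. If \<open>S\<close> were large on that coset, the vanishing total would force it to
  be large elsewhere as well, and Cauchy-Schwarz turns this into exactly the bound above
  (\<open>constant_part_of_zero_sum\<close>).

  The second one is \<open>\<Sum> \<bar>H'(k)\<bar> \<le> (4/\<pi>\<^sup>2) p log(3p)\<close> over \<open>k \<noteq> 0\<close>
  (\<open>sum_norm_exp_sum_upper_half_le\<close>). As \<open>H\<close> has length \<open>(p-1)/2\<close>, the geometric sum simplifies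
  to \<open>\<bar>H'(k)\<bar> = 1 / (2 sin(\<pi>k/2p))\<close> for odd \<open>k\<close>, and \<open>\<bar>H'(p-k)\<bar> = \<bar>H'(k)\<bar>\<close> covers the even
  ones. The resulting sum of cosecants grows like \<open>(1/\<pi>) p log p\<close>, and \<open>1/\<pi> < 4/\<pi>\<^sup>2\<close> leaves room
  for the lower order terms, already from \<open>p = 3\<close> on.
\<close>

section \<open>Additive characters and exponential sums\<close>

definition add_char :: "nat \<Rightarrow> int \<Rightarrow> complex" where
  "add_char p k = cis (2 * pi * real_of_int k / real p)"

lemma add_char_0 [simp]: "add_char p 0 = 1"
  by (simp add: add_char_def)

lemma add_char_add: "add_char p (k + l) = add_char p k * add_char p l"
  by (simp add: add_char_def cis_mult ring_distribs add_divide_distrib)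

lemma cnj_add_char: "cnj (add_char p k) = add_char p (- k)"
  by (simp add: add_char_def cis_cnj)

lemma add_char_power: "add_char p k ^ n = add_char p (int n * k)"
  unfolding add_char_def Complex.DeMoivre by (simp add: mult_ac)

lemma add_char_eq_1_iff:
  assumes "p > 0"
  shows "add_char p k = 1 \<longleftrightarrow> int p dvd k"
proof -
  have "add_char p k = 1 \<longleftrightarrow> (\<exists>n::int. 2 * pi * real_of_int k / real p = 2 * pi * real_of_int n)"
    unfolding add_char_def cis_conv_exp exp_eq_1 by (auto simp: mult_ac)
  also have "\<dots> \<longleftrightarrow> (\<exists>n::int. real_of_int k = real_of_int (int p * n))"
    using assms by (auto simp: field_simps)
  also have "\<dots> \<longleftrightarrow> int p dvd k"
    unfolding of_int_eq_iff dvd_def by simp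
  finally show ?thesis .
qed

lemma add_char_cong:
  assumes "p > 0" "[k = l] (mod int p)"
  shows "add_char p k = add_char p l"
proof -
  have "add_char p (k - l) = 1"
    using assms add_char_eq_1_iff by (simp add: cong_iff_dvd_diff)
  then show ?thesis
    using add_char_add[of p "k - l" l] by simp
qed

lemma sum_add_char:
  assumes "p > 0"
  shows "(\<Sum>k\<in>{0..<int p}. add_char p (k * m)) = (if int p dvd m then of_nat p else 0)"
proof -
  have "(\<Sum>k\<in>{0..<int p}. add_char p (k * m)) = (\<Sum>k<p. add_char p m ^ k)"
    by (rule sum.reindex_bij_witness[of _ int nat]) (auto simp: add_char_power)
  also have "\<dots> = (if int p dvd m then of_nat p else 0)"
  proof (cases "int p dvd m")
    case True
    then have "add_char p m = 1" using add_char_eq_1_iff assms by simp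
    then show ?thesis using True by simp
  next
    case False
    then have "add_char p m \<noteq> 1" "add_char p m ^ p = 1"
      using add_char_eq_1_iff assms by (simp_all add: add_char_power)
    then show ?thesis
      using False by (simp add: geometric_sum)
  qed
  finally show ?thesis .
qed

definition exp_sum :: "nat \<Rightarrow> (int \<Rightarrow> int) \<Rightarrow> int set \<Rightarrow> int \<Rightarrow> complex" where
  "exp_sum p f X k = (\<Sum>x\<in>X. add_char p (k * f x))"

lemma exp_sum_0: "exp_sum p f X 0 = of_nat (card X)"
  by (simp add: exp_sum_def)

lemma norm_exp_sum_uminus: "norm (exp_sum p f X (- k)) = norm (exp_sum p f X k)"
proof -
  have "exp_sum p f X (- k) = cnj (exp_sum p f X k)"
    by (simp add: exp_sum_def cnj_add_char)
  then show ?thesis by simp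
qed

lemma exp_sum_cong_freq:
  assumes "p > 0" "[k = l] (mod int p)"
  shows "exp_sum p f X k = exp_sum p f X l"
  unfolding exp_sum_def using assms by (intro sum.cong add_char_cong) (auto intro: cong_mult)

lemma sum_exp_sum:
  assumes "p > 0" "finite X"
  shows "(\<Sum>k\<in>{0..<int p}. exp_sum p f X k) = of_nat (p * card {x \<in> X. int p dvd f x})"
proof -
  have "(\<Sum>k\<in>{0..<int p}. exp_sum p f X k) = (\<Sum>x\<in>X. \<Sum>k\<in>{0..<int p}. add_char p (k * f x))"
    unfolding exp_sum_def by (rule sum.swap)
  also have "\<dots> = (\<Sum>x\<in>X. if int p dvd f x then of_nat p else 0)"
    using assms by (simp add: sum_add_char)
  also have "\<dots> = of_nat (p * card {x \<in> X. int p dvd f x})"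
    using assms by (simp add: sum.If_cases Int_def conj_commute)
  finally show ?thesis .
qed

text \<open>
  Expanding the product and summing over the frequency first leaves, by orthogonality, only the
  pairs with congruent values. With \<open>g = f\<close> this is Parseval's identity; with \<open>Y\<close> a set of
  target values and \<open>g\<close> the identity it counts how often \<open>f\<close> hits \<open>Y\<close>.
\<close>
lemma sum_exp_sum_times_cnj:
  assumes "p > 0" "finite X" "finite Y"
  shows "(\<Sum>k\<in>{0..<int p}. exp_sum p f X k * cnj (exp_sum p g Y k))
           = of_nat (p * card {(x, y) \<in> X \<times> Y. [f x = g y] (mod int p)})"
proof -
  have "exp_sum p f X k * cnj (exp_sum p g Y k) = (\<Sum>(x, y)\<in>X \<times> Y. add_char p (k * (f x - g y)))" for k
    by (simp add: exp_sum_def cnj_add_char sum_product sum.cartesian_product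
                  right_diff_distrib add_char_add[of p _ "- _", simplified])
  then have "(\<Sum>k\<in>{0..<int p}. exp_sum p f X k * cnj (exp_sum p g Y k))
     = (\<Sum>k\<in>{0..<int p}. \<Sum>(x, y)\<in>X \<times> Y. add_char p (k * (f x - g y)))"
    by (simp add: exp_sum_def)
  also have "\<dots> = (\<Sum>(x, y)\<in>X \<times> Y. \<Sum>k\<in>{0..<int p}. add_char p (k * (f x - g y)))"
    by (subst sum.swap) (simp add: case_prod_unfold)
  also have "\<dots> = (\<Sum>z\<in>X \<times> Y. if [f (fst z) = g (snd z)] (mod int p) then of_nat p else 0)"
    using assms by (intro sum.cong) (auto simp: sum_add_char cong_iff_dvd_diff)
  also have "\<dots> = of_nat (p * card {(x, y) \<in> X \<times> Y. [f x = g y] (mod int p)})"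
    using assms by (simp add: sum.If_cases Int_def case_prod_unfold conj_assoc mem_Times_iff)
  finally show ?thesis .
qed

lemma sum_norm_exp_sum_squared:
  assumes "p > 0" "finite X"
  shows "(\<Sum>k\<in>{0..<int p}. (norm (exp_sum p f X k))\<^sup>2)
           = real (p * card {(x, y) \<in> X \<times> X. [f x = f y] (mod int p)})"
proof -
  have "complex_of_real (\<Sum>k\<in>{0..<int p}. (norm (exp_sum p f X k))\<^sup>2)
      = complex_of_real (real (p * card {(x, y) \<in> X \<times> X. [f x = f y] (mod int p)}))"
    using sum_exp_sum_times_cnj[OF assms(1) assms(2) assms(2), of f f]
    by (simp add: complex_norm_square[unfolded of_real_power])
  then show ?thesis by (simp only: of_real_eq_iff)
qed

section \<open>Power sums modulo a prime\<close>

text \<open>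
  The values outside \<open>C\<close> must add up to \<open>- card C \<cdot> s\<close>, and by Cauchy-Schwarz they cannot do
  so cheaply: the energy they need comes on top of the energy \<open>card C \<cdot> \<bar>s\<bar>\<^sup>2\<close> spent on \<open>C\<close>.
  Without the zero sum one would only get \<open>card C \<cdot> \<bar>s\<bar>\<^sup>2 \<le> V\<close>, which for power sums is weaker
  than the square-root bound with the factor \<open>d - 1\<close>.
\<close>
lemma constant_part_of_zero_sum:
  fixes S :: "'a \<Rightarrow> 'b :: real_normed_vector"
  assumes "finite K" "C \<subseteq> K" and zero: "(\<Sum>k\<in>K. S k) = 0"
    and energy: "(\<Sum>k\<in>K. (norm (S k))\<^sup>2) \<le> V" and const: "\<And>k. k \<in> C \<Longrightarrow> S k = s"
  shows "real (card K) * real (card C) * (norm s)\<^sup>2 \<le> (real (card K) - real (card C)) * V"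
proof (cases "C = {}")
  case True
  have "0 \<le> V" using energy by (meson order_trans sum_nonneg zero_le_power2)
  then show ?thesis using True by simp
next
  case False
  define m n where "m = real (card C)" and "n = real (card (K - C))"
  have fin: "finite C" using assms finite_subset by blast
  have m: "m > 0" using False fin by (simp add: m_def card_gt_0_iff)
  have n: "n = real (card K) - m"
    using assms fin by (simp add: n_def m_def card_Diff_subset of_nat_diff card_mono)
  have "(\<Sum>k\<in>K - C. S k) + (\<Sum>k\<in>C. S k) = 0"
    using sum.subset_diff[OF assms(2,1), of S] zero by simp
  moreover have "(\<Sum>k\<in>C. S k) = m *\<^sub>R s"
    using const by (simp add: m_def sum_constant_scaleR)
  ultimately have "(\<Sum>k\<in>K - C. S k) = - (m *\<^sub>R s)"
    by (simp add: eq_neg_iff_add_eq_0)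
  then have "m * norm s = norm (\<Sum>k\<in>K - C. S k)"
    using m by simp
  also have "\<dots> \<le> (\<Sum>k\<in>K - C. norm (S k))" by (rule norm_sum)
  finally have "(m * norm s)\<^sup>2 \<le> (\<Sum>k\<in>K - C. norm (S k) * 1)\<^sup>2"
    using m by (intro power_mono) auto
  also have "\<dots> \<le> (\<Sum>k\<in>K - C. (norm (S k))\<^sup>2) * (\<Sum>k\<in>K - C. 1\<^sup>2)"
    by (rule Cauchy_Schwarz_ineq_sum)
  also have "\<dots> = (\<Sum>k\<in>K - C. (norm (S k))\<^sup>2) * n"
    by (simp add: n_def)
  also have "(\<Sum>k\<in>K - C. (norm (S k))\<^sup>2) \<le> V - m * (norm s)\<^sup>2"
    using sum.subset_diff[OF assms(2,1), of "\<lambda>k. (norm (S k))\<^sup>2"] energy const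
    by (simp add: m_def)
  then have "(\<Sum>k\<in>K - C. (norm (S k))\<^sup>2) * n \<le> (V - m * (norm s)\<^sup>2) * n"
    by (intro mult_right_mono) (auto simp: n_def)
  finally have "m * ((m + n) * (norm s)\<^sup>2) \<le> (V - m * (norm s)\<^sup>2) * n + m * n * (norm s)\<^sup>2"
    by (simp add: power2_eq_square algebra_simps)
  also have "\<dots> = n * V" by (simp add: algebra_simps)
  finally show ?thesis using n by (simp add: m_def algebra_simps)
qed

lemma card_roots_mod_prime_le:
  fixes c :: int
  assumes "prime p" "d > 0"
  shows "card {x \<in> {0..<int p}. [x ^ d = c] (mod int p)} \<le> d"
proof -
  define c' where "c' = nat (c mod int p)"
  have p: "p > 0" using assms prime_gt_0_nat by blast
  have c': "[int c' = c] (mod int p)" using p by (simp add: c'_def Cong.cong_def)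
  have "int ` {x \<in> {..<p}. [x ^ d = c'] (mod p)} = {x \<in> {0..<int p}. [x ^ d = c] (mod int p)}"
    (is "?L = ?R")
  proof (intro equalityI subsetI)
    fix x assume "x \<in> ?L"
    then obtain n where n: "x = int n" "n < p" "[n ^ d = c'] (mod p)" by auto
    then have "[int (n ^ d) = int c'] (mod int p)" by (simp only: cong_int_iff)
    then show "x \<in> ?R" using n c' by (auto intro: cong_trans)
  next
    fix x assume x: "x \<in> ?R"
    then have "[int (nat x ^ d) = int c'] (mod int p)"
      using c' by (auto intro: cong_trans cong_sym)
    then have "[nat x ^ d = c'] (mod p)" by (simp only: cong_int_iff)
    then show "x \<in> ?L" using x by (intro image_eqI[of _ _ "nat x"]) auto
  qed
  then have "card {x \<in> {0..<int p}. [x ^ d = c] (mod int p)} = card {x \<in> {..<p}. [x ^ d = c'] (mod p)}"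
    using card_image[of int "{x \<in> {..<p}. [x ^ d = c'] (mod p)}"] by simp
  then show ?thesis using roots_mod_prime_bound[OF assms] by simp
qed

text \<open>
  The solution \<open>(0, 0)\<close> is the only one with a vanishing coordinate; separating it lowers
  the energy bound for the nonzero frequencies from \<open>p\<^sup>2 (d-1)\<close> to \<open>p (p-1) (d-1)\<close>, which the
  exact constant in \<open>(d-1) \<surd>p\<close> requires.
\<close>
lemma card_equal_powers_mod_prime_le:
  assumes "prime p" "d > 0"
  shows "card {(x, y) \<in> {0..<int p} \<times> {0..<int p}. [x ^ d = y ^ d] (mod int p)} \<le> 1 + (p - 1) * d"
proof -
  let ?F = "\<lambda>x. {y \<in> {0..<int p}. [y ^ d = x ^ d] (mod int p)}"
  have p: "p > 1" using assms prime_gt_1_nat by blast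
  have split: "{0..<int p} = insert 0 {1..<int p}" using p by auto
  have "{(x, y) \<in> {0..<int p} \<times> {0..<int p}. [x ^ d = y ^ d] (mod int p)} = (SIGMA x:{0..<int p}. ?F x)"
    by (auto simp: cong_sym_eq)
  then have "card {(x, y) \<in> {0..<int p} \<times> {0..<int p}. [x ^ d = y ^ d] (mod int p)} = (\<Sum>x\<in>{0..<int p}. card (?F x))"
    by (simp only:) (intro card_SigmaI ballI finite_Collect_conjI; simp)
  also have "\<dots> = card (?F 0) + (\<Sum>x\<in>{1..<int p}. card (?F x))"
    using sum.insert[of "{1..<int p}" 0 "\<lambda>x. card (?F x)"] split by simp
  also have "\<dots> \<le> 1 + (\<Sum>x\<in>{1..<int p}. d)"
  proof (intro add_mono sum_mono)
    have "?F 0 \<subseteq> {0}"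
    proof
      fix y assume y: "y \<in> ?F 0"
      then have "int p dvd y"
        using assms by (auto simp: cong_0_iff zero_power intro: prime_dvd_power)
      then show "y \<in> {0}" using y zdvd_not_zless[of y "int p"] by force
    qed
    then show "card (?F 0) \<le> 1" using card_mono[of "{0}" "?F 0"] by simp
  qed (rule card_roots_mod_prime_le[OF assms])
  also have "\<dots> = 1 + (p - 1) * d" using p by (simp add: nat_diff_distrib)
  finally show ?thesis .
qed

lemma bij_betw_mult_mod_prime:
  assumes "prime p" "\<not> int p dvd a"
  shows "bij_betw (\<lambda>x. a * x mod int p) {0..<int p} {0..<int p}"
proof -
  have p: "p > 0" using assms prime_gt_0_nat by blast
  have "inj_on (\<lambda>x. a * x mod int p) {0..<int p}"
  proof (rule inj_onI)
    fix x y assume xy: "x \<in> {0..<int p}" "y \<in> {0..<int p}" and "a * x mod int p = a * y mod int p"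
    then have "[a * x = a * y] (mod int p)" by (simp add: Cong.cong_def)
    moreover have "coprime a (int p)"
      using assms residues_prime.p_coprime_right_int[OF residues_prime.intro] by blast
    ultimately have "[x = y] (mod int p)" using cong_mult_lcancel by blast
    then show "x = y" using xy by (simp add: Cong.cong_def)
  qed
  moreover have "(\<lambda>x. a * x mod int p) ` {0..<int p} \<subseteq> {0..<int p}" using p by auto
  ultimately show ?thesis
    by (simp add: bij_betw_def endo_inj_surj)
qed

text \<open>
  A factor \<open>a\<^sup>d\<close> in the frequency is absorbed by the substitution \<open>x \<mapsto> a x\<close>, which permutes
  the residues.
\<close>
lemma power_sum_scale_freq:
  assumes "prime p" "\<not> int p dvd a"
  shows "exp_sum p (\<lambda>x. x ^ d) {0..<int p} (k * a ^ d) = exp_sum p (\<lambda>x. x ^ d) {0..<int p} k"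
proof -
  have p: "p > 0" using assms prime_gt_0_nat by blast
  have "exp_sum p (\<lambda>x. x ^ d) {0..<int p} (k * a ^ d)
      = (\<Sum>x\<in>{0..<int p}. add_char p (k * (a * x mod int p) ^ d))"
    unfolding exp_sum_def
  proof (intro sum.cong refl add_char_cong p)
    fix x
    have "[(a * x mod int p) ^ d = (a * x) ^ d] (mod int p)" by (intro cong_pow) simp
    then have "[k * (a * x mod int p) ^ d = k * (a * x) ^ d] (mod int p)"
      by (intro cong_mult cong_refl)
    then show "[k * a ^ d * x ^ d = k * (a * x mod int p) ^ d] (mod int p)"
      by (simp add: power_mult_distrib mult_ac cong_sym_eq)
  qed
  also have "\<dots> = exp_sum p (\<lambda>x. x ^ d) {0..<int p} k"
    unfolding exp_sum_def by (rule sum.reindex_bij_betw[OF bij_betw_mult_mod_prime[OF assms]])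
  finally show ?thesis .
qed

text \<open>
  The variance argument \<open>constant_part_of_zero_sum\<close> is applied to the nonzero frequencies, with
  \<open>C\<close> the coset \<open>{k a\<^sup>d}\<close>. This reaches the bound that is usually obtained by writing the power
  sum as a sum of \<open>d - 1\<close> Gauss sums of absolute value \<open>\<surd>p\<close>.
\<close>
theorem norm_power_sum_le:
  assumes "prime p" "d > 0" "\<not> int p dvd k"
  shows "norm (exp_sum p (\<lambda>x. x ^ d) {0..<int p} k) \<le> (real d - 1) * sqrt (real p)"
proof -
  define S where "S = exp_sum p (\<lambda>x. x ^ d) {0..<int p}"
  define C where "C = (\<lambda>a. k * a ^ d mod int p) ` {1..<int p}"
  have p: "p > 1" using assms prime_gt_1_nat by blast
  have ndvd: "\<not> int p dvd a" if "a \<in> {1..<int p}" for a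
    using that zdvd_not_zless by auto
  have split: "{0..<int p} = insert 0 {1..<int p}" using p by auto
  have S0: "S 0 = of_nat p" by (simp add: S_def exp_sum_0)
  have C: "C \<subseteq> {1..<int p}"
  proof
    fix c assume "c \<in> C"
    then obtain a where a: "a \<in> {1..<int p}" "c = k * a ^ d mod int p" unfolding C_def by blast
    have "\<not> int p dvd k * a ^ d"
      using ndvd[OF a(1)] assms by (auto simp: prime_dvd_mult_iff dest: prime_dvd_power[rotated])
    then have "c \<noteq> 0" using a by (simp add: dvd_eq_mod_eq_0)
    moreover have "0 \<le> c" "c < int p" using a p by auto
    ultimately show "c \<in> {1..<int p}" by simp
  qed
  have const: "S c = S k" if "c \<in> C" for c
  proof -
    obtain a where a: "a \<in> {1..<int p}" "c = k * a ^ d mod int p" using \<open>c \<in> C\<close> unfolding C_def by blast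
    have "S c = S (k * a ^ d)"
      using p by (auto simp: S_def a(2) intro: exp_sum_cong_freq)
    also have "\<dots> = S k" unfolding S_def by (rule power_sum_scale_freq[OF assms(1) ndvd[OF a(1)]])
    finally show ?thesis .
  qed
  have zero: "(\<Sum>l\<in>{1..<int p}. S l) = 0"
  proof -
    have "{x \<in> {0..<int p}. int p dvd x ^ d} = {0}"
      using p assms ndvd by (auto simp: split zero_power dest: prime_dvd_power[rotated])
    then have "(\<Sum>l\<in>{0..<int p}. S l) = of_nat p"
      using sum_exp_sum[of p "{0..<int p}" "\<lambda>x. x ^ d"] p by (simp add: S_def)
    then show ?thesis by (simp add: split S0)
  qed
  have energy: "(\<Sum>l\<in>{1..<int p}. (norm (S l))\<^sup>2) \<le> real p * (real p - 1) * (real d - 1)"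
  proof -
    have "real p ^ 2 + (\<Sum>l\<in>{1..<int p}. (norm (S l))\<^sup>2) = (\<Sum>l\<in>{0..<int p}. (norm (S l))\<^sup>2)"
      by (simp add: split S0)
    also have "\<dots> \<le> real (p * (1 + (p - 1) * d))"
      unfolding S_def using p card_equal_powers_mod_prime_le[OF assms(1,2)]
      by (subst sum_norm_exp_sum_squared) (simp_all only: of_nat_le_iff mult_le_mono2, simp_all)
    also have "\<dots> = real p * (1 + (real p - 1) * real d)"
      using p by (simp add: of_nat_diff distrib_left)
    finally show ?thesis by (simp add: algebra_simps power2_eq_square)
  qed
  \<comment> \<open>Each element of the coset comes from at most \<open>d\<close> values of \<open>a\<close>.\<close>
  have size: "real p - 1 \<le> real (card C) * real d"
  proof -
    let ?f = "\<lambda>a. k * a ^ d mod int p"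
    have "card {1..<int p} = (\<Sum>c\<in>C. card {a \<in> {1..<int p}. ?f a = c})"
      using sum.image_gen[of "{1..<int p}" "\<lambda>_. 1::nat" ?f] by (simp add: C_def)
    also have "\<dots> \<le> (\<Sum>c\<in>C. d)"
    proof (rule sum_mono)
      fix c assume "c \<in> C"
      then obtain b where b: "b \<in> {1..<int p}" "c = ?f b" unfolding C_def by blast
      have "coprime k (int p)" using assms residues_prime.p_coprime_right_int[OF residues_prime.intro] by blast
      then have "{a \<in> {1..<int p}. ?f a = c} \<subseteq> {a \<in> {0..<int p}. [a ^ d = b ^ d] (mod int p)}"
        using b by (auto simp: cong_mult_lcancel simp flip: Cong.cong_def)
      then have "card {a \<in> {1..<int p}. ?f a = c} \<le> card {a \<in> {0..<int p}. [a ^ d = b ^ d] (mod int p)}"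
        by (rule card_mono[rotated]) (rule finite_subset[of _ "{0..<int p}"], auto)
      also have "\<dots> \<le> d" by (rule card_roots_mod_prime_le[OF assms(1,2)])
      finally show "card {a \<in> {1..<int p}. ?f a = c} \<le> d" .
    qed
    finally have "real (card {1..<int p}) \<le> real (card C * d)"
      by (simp only: of_nat_le_iff) simp
    then show ?thesis using p by (simp add: nat_diff_distrib of_nat_diff)
  qed
  define m q where "m = real (card C)" and "q = real p - 1"
  have q: "q > 0" using p by (simp add: q_def)
  have "0 < m * real d" using size q by (simp add: m_def q_def)
  then have m: "m > 0" using assms by (simp add: zero_less_mult_iff)
  have d: "real d \<ge> 1" using assms by simp
  have "q * m * (norm (S k))\<^sup>2 \<le> (q - m) * (real p * q * (real d - 1))"
    using constant_part_of_zero_sum[OF _ C zero energy const] p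
    by (simp add: m_def q_def nat_diff_distrib of_nat_diff)
  also have "\<dots> \<le> ((real d - 1) * m) * (real p * q * (real d - 1))"
  proof (rule mult_right_mono)
    show "q - m \<le> (real d - 1) * m" using size by (simp add: m_def q_def algebra_simps)
    show "0 \<le> real p * q * (real d - 1)" using d q by simp
  qed
  also have "\<dots> = q * m * ((real d - 1) * sqrt (real p))\<^sup>2"
    by (simp add: power_mult_distrib power2_eq_square algebra_simps)
  finally have "(norm (S k))\<^sup>2 \<le> ((real d - 1) * sqrt (real p))\<^sup>2"
    using m q by (simp add: mult_le_cancel_left_pos)
  then have "norm (S k) \<le> (real d - 1) * sqrt (real p)"
    by (rule power2_le_imp_le) (use d in simp)
  then show ?thesis by (simp add: S_def)
qed

section \<open>A sum of cosecants\<close>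

text \<open>
  From \<open>sin t \<ge> t - t\<^sup>3/6\<close> one gets \<open>sin t (1/t + t/3) \<ge> 1 + t\<^sup>2 (3 - t\<^sup>2)/18\<close>, and
  \<open>t\<^sup>2 \<le> \<pi>\<^sup>2/4 < 3\<close>. The cruder bound \<open>1 / sin t \<le> \<pi>/(2t)\<close> would lose the constant \<open>4/\<pi>\<^sup>2\<close>
  in the final estimate: it leads to a leading coefficient \<open>1/2\<close> instead of \<open>1/\<pi>\<close>.
\<close>
lemma inverse_sin_le:
  fixes t :: real
  assumes "0 < t" "t \<le> pi / 2"
  shows "1 / sin t \<le> 1 / t + t / 3"
proof -
  have "t < 1.6" using assms pi_approx(2) by simp
  then have t2: "t\<^sup>2 \<le> 3"
    using assms power_mono[of t "1.6" 2] by (simp add: power2_eq_square)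
  have sin: "t * (1 - t\<^sup>2 / 6) \<le> sin t"
  proof -
    have "\<bar>sin t - (\<Sum>m<3. sin_coeff m * t ^ m)\<bar> \<le> inverse (fact 3) * \<bar>t\<bar> ^ 3"
      by (rule Maclaurin_sin_bound)
    moreover have "(\<Sum>m<3. sin_coeff m * t ^ m) = t"
      by (simp add: numeral_3_eq_3 sin_coeff_def)
    moreover have "inverse (fact 3) * \<bar>t\<bar> ^ 3 = t ^ 3 / 6"
      using assms by (simp add: fact_numeral)
    ultimately show ?thesis by (simp only: abs_le_iff) (simp add: algebra_simps power2_eq_square power3_eq_cube)
  qed
  have "0 \<le> t\<^sup>2 * (3 - t\<^sup>2) / 18"
    using t2 by simp
  then have "1 \<le> (t * (1 - t\<^sup>2 / 6)) * (1 / t + t / 3)"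
    using assms by (simp add: field_simps power2_eq_square)
  also have "\<dots> \<le> sin t * (1 / t + t / 3)"
    using sin assms by (intro mult_right_mono) auto
  finally show ?thesis
    using assms sin_gt_zero[of t] by (simp add: divide_le_eq mult.commute)
qed

text \<open>
  By convexity of the reciprocal, \<open>2/(2L+1)\<close>, its value at the midpoint of \<open>[L, L+1]\<close>, is at most
  its integral \<open>ln (L+1) - ln L\<close>.
\<close>
lemma sum_odd_reciprocals_le:
  assumes "L > 0"
  shows "(\<Sum>j<L. 1 / (2 * real j + 1)) \<le> 1 + ln (real L) / 2"
  using assms
proof (induction L rule: nat_induct_non_zero)
  case 1
  then show ?case by simp
next
  case (Suc L)
  have "ln (real L + 1) - ln (real L) \<ge> 2 * ((real L + 1) - real L) / (real L + (real L + 1))"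
    using Suc by (intro ln_inverse_approx_ge) auto
  then have "1 / (2 * real L + 1) \<le> ln (real (Suc L)) / 2 - ln (real L) / 2"
    by (simp add: field_simps add.commute)
  then show ?case using Suc.IH by simp
qed

lemma sum_odd_numbers: "(\<Sum>j<L. 2 * real j + 1) = (real L)\<^sup>2"
  by (induction L) (simp_all add: power2_eq_square algebra_simps)

text \<open>
  The left side is the estimate for the cosecant sum, scaled by \<open>\<pi>\<^sup>2/p\<close>, for
  \<open>p = 2L+1\<close>. The coefficient \<open>\<pi>\<close> of \<open>ln L\<close> is smaller than \<open>4\<close>, so the gap grows with \<open>L\<close>.
  Writing \<open>ln (3p) \<ge> ln 6 + ln L\<close> is precise enough from \<open>L = 2\<close> on, but not for \<open>L = 1\<close>,
  where \<open>ln L\<close> vanishes and \<open>ln 9 \<ge> 2\<close> is used instead.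
\<close>
lemma sine_sum_numeric_bound:
  assumes "L > 0"
  shows "pi * (2 + ln (real L)) + pi ^ 3 / 24 \<le> 4 * ln (3 * (2 * real L + 1))"
proof -
  have pi: "pi \<le> 3.142" using pi_approx(2) by simp
  have pi3: "pi ^ 3 \<le> 31.04"
    using power_mono[OF pi, of 3] by (simp add: power3_eq_cube)
  have e: "exp 1 < (2.72 :: real)" using e_less_272 by simp
  show ?thesis
  proof (cases "L = 1")
    case True
    have "exp (2::real) = exp 1 ^ 2" by (simp flip: exp_of_nat_mult)
    also have "\<dots> \<le> 2.72 ^ 2" using e by (intro power_mono) auto
    also have "\<dots> \<le> 9" by (simp add: power2_eq_square)
    finally have "2 \<le> ln (9::real)" by (simp add: ln_ge_iff)
    then show ?thesis using True pi pi3 by simp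
  next
    case False
    then have L: "real L \<ge> 2" using assms by linarith
    \<comment> \<open>The rationals \<open>7/4 \<le> ln 6\<close> and \<open>17/25 \<le> ln 2\<close> come from \<open>2.72\<^sup>7 \<le> 6\<^sup>4\<close> and \<open>2.72\<^bsup>17\<^esup> \<le> 2\<^bsup>25\<^esup>\<close>.\<close>
    have "exp (7/4::real) ^ 4 = exp 1 ^ 7" by (simp flip: exp_of_nat_mult)
    also have "\<dots> \<le> 2.72 ^ 7" using e by (intro power_mono) auto
    also have "\<dots> \<le> 6 ^ 4" by (simp add: power_divide)
    finally have "exp (7/4::real) \<le> 6" by (subst (asm) power_mono_iff) simp_all
    then have ln6: "7/4 \<le> ln (6::real)" by (subst ln_ge_iff) simp_all
    have ln2: "0.68 \<le> ln (real L)"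
    proof -
      have "exp (0.68::real) ^ 25 = exp 1 ^ 17" by (simp flip: exp_of_nat_mult)
      also have "\<dots> \<le> 2.72 ^ 17" using e by (intro power_mono) auto
      also have "\<dots> \<le> 2 ^ 25" by (simp add: power_divide)
      finally have "exp (0.68::real) \<le> 2" by (subst (asm) power_mono_iff) simp_all
      then have "exp 0.68 \<le> real L" using L by linarith
      then show ?thesis using L by (subst ln_ge_iff) auto
    qed
    have "ln 6 + ln (real L) = ln (6 * real L)" using L by (simp add: ln_mult)
    also have "\<dots> \<le> ln (3 * (2 * real L + 1))" using L by simp
    finally have "4 * ln 6 + 4 * ln (real L) \<le> 4 * ln (3 * (2 * real L + 1))" by simp
    moreover have "(4 - pi) * ln (real L) \<ge> 0.858 * 0.68"
      using pi ln2 by (intro mult_mono) auto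
    ultimately show ?thesis using ln6 pi pi3 by (simp add: algebra_simps)
  qed
qed

lemma sum_inverse_sin_odd_le:
  assumes "p = 2 * L + 1" "L > 0"
  shows "(\<Sum>j<L. 1 / sin (pi * (2 * real j + 1) / (2 * real p))) \<le> real p * (4 / pi\<^sup>2 * ln (3 * real p))"
proof -
  have p: "real p = 2 * real L + 1" "real p > 0" using assms by simp_all
  have "(\<Sum>j<L. 1 / sin (pi * (2 * real j + 1) / (2 * real p)))
      \<le> (\<Sum>j<L. (2 * real p / pi) * (1 / (2 * real j + 1)) + pi / (6 * real p) * (2 * real j + 1))"
  proof (rule sum_mono)
    fix j assume j: "j \<in> {..<L}"
    let ?t = "pi * (2 * real j + 1) / (2 * real p)"
    have "2 * real j + 1 \<le> real p" using j p by simp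
    then have "?t \<le> pi / 2" using p by (simp add: field_simps)
    moreover have "?t > 0" using p by (intro divide_pos_pos mult_pos_pos) auto
    ultimately have "1 / sin ?t \<le> 1 / ?t + ?t / 3" by (intro inverse_sin_le)
    also have "\<dots> = (2 * real p / pi) * (1 / (2 * real j + 1)) + pi / (6 * real p) * (2 * real j + 1)"
      by simp
    finally show "1 / sin ?t \<le> \<dots>" .
  qed
  also have "\<dots> = (2 * real p / pi) * (\<Sum>j<L. 1 / (2 * real j + 1)) + pi / (6 * real p) * (real L)\<^sup>2"
    by (simp only: sum.distrib[of "\<lambda>j. (2 * real p / pi) * (1 / (2 * real j + 1))"] sum_odd_numbers flip: sum_distrib_left)
  also have "\<dots> \<le> (2 * real p / pi) * (1 + ln (real L) / 2) + pi / (6 * real p) * (real p / 2)\<^sup>2"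
    using p by (intro add_mono mult_left_mono sum_odd_reciprocals_le[OF assms(2)] power_mono) auto
  also have "\<dots> = real p / pi\<^sup>2 * (pi * (2 + ln (real L)) + pi ^ 3 / 24)"
    using p(2) by (simp add: field_simps power2_eq_square power3_eq_cube)
  also have "\<dots> \<le> real p / pi\<^sup>2 * (4 * ln (3 * real p))"
    using sine_sum_numeric_bound[OF assms(2)] p by (intro mult_left_mono) auto
  finally show ?thesis by (simp add: mult_ac)
qed

section \<open>The Fourier transform of the upper half interval\<close>

lemma norm_add_char_diff_1: "norm (add_char p k - 1) = 2 * \<bar>sin (pi * real_of_int k / real p)\<bar>"
  unfolding add_char_def cis_conv_exp
  using dist_exp_i_1[of "2 * pi * real_of_int k / real p"] by (simp add: mult_ac)

lemma sum_power_interval_telescope: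
  fixes z :: "'a :: comm_ring_1"
  shows "m \<le> n \<Longrightarrow> (z - 1) * (\<Sum>h=m..<n. z ^ h) = z ^ n - z ^ m"
  by (induction n rule: dec_induct) (simp_all add: algebra_simps)

text \<open>
  With \<open>z = e(k)\<close> and \<open>t = \<pi>k/2p\<close>, the geometric sum over \<open>{L+1..p-1}\<close> is
  \<open>(1 - z\<^bsup>L+1\<^esup>)/(z - 1)\<close>. Its denominator has absolute value \<open>2 sin 2t = 4 sin t cos t\<close>. Its
  numerator has absolute value \<open>2 \<bar>sin(2(L+1)t)\<bar> = 2 \<bar>sin(t + k\<pi>/2)\<bar>\<close>, as \<open>2(L+1) = p + 1\<close>,
  and this is \<open>2 cos t\<close> for odd \<open>k\<close>.
\<close>
lemma norm_exp_sum_upper_half_odd: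
  assumes p: "p = 2 * L + 1" and k: "k = 2 * int j + 1" and j: "j < L"
  shows "norm (exp_sum p (\<lambda>h. h) {int L + 1..<int p} k) = 1 / (2 * sin (pi * (2 * real j + 1) / (2 * real p)))"
proof -
  define t where "t = pi * (2 * real j + 1) / (2 * real p)"
  have pos: "real p > 0" using p by simp
  have t: "0 < t" "t < pi / 2"
    using j by (auto simp: t_def p field_simps add_pos_nonneg)
  have sin: "sin t > 0" and cos: "cos t > 0" using t sin_gt_zero2 cos_gt_zero by auto
  define z where "z = add_char p k"
  have z: "z ^ p = 1" using pos by (simp add: z_def add_char_power add_char_eq_1_iff)
  have "exp_sum p (\<lambda>h. h) {int L + 1..<int p} k = (\<Sum>h=L+1..<p. z ^ h)"
    unfolding exp_sum_def z_def
    by (rule sum.reindex_bij_witness[of _ int nat]) (auto simp: add_char_power mult.commute)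
  moreover have "(z - 1) * (\<Sum>h=L+1..<p. z ^ h) = 1 - z ^ (L + 1)"
    using sum_power_interval_telescope[of "L + 1" p z] z p by simp
  ultimately have "norm (z - 1) * norm (exp_sum p (\<lambda>h. h) {int L + 1..<int p} k) = norm (z ^ (L + 1) - 1)"
    by (metis norm_minus_commute norm_mult)
  moreover have "norm (z - 1) = 4 * sin t * cos t"
  proof -
    have "pi * real_of_int k / real p = 2 * t" using pos by (simp add: t_def k)
    then show ?thesis
      using sin cos by (simp add: z_def norm_add_char_diff_1 sin_double abs_mult)
  qed
  moreover have "norm (z ^ (L + 1) - 1) = 2 * cos t"
  proof -
    have "pi * real_of_int (int (L + 1) * k) / real p = t + pi * (2 * real j + 1) / 2"
      by (simp add: t_def k p field_simps)
    also have "\<dots> = (t + pi / 2) + real j * pi" by (simp add: field_simps)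
    finally have eq: "pi * real_of_int (int (L + 1) * k) / real p = (t + pi / 2) + real j * pi" .
    have "\<bar>sin ((t + pi / 2) + real j * pi)\<bar> = cos t"
      unfolding sin_add[of "t + pi / 2"] using cos
      by (simp add: sin_add abs_mult power_abs)
    then show ?thesis
      unfolding z_def add_char_power norm_add_char_diff_1 eq by simp
  qed
  ultimately have "4 * sin t * cos t * norm (exp_sum p (\<lambda>h. h) {int L + 1..<int p} k) = 2 * cos t"
    by simp
  then have "norm (exp_sum p (\<lambda>h. h) {int L + 1..<int p} k) = 1 / (2 * sin t)"
    using sin cos by (simp add: field_simps)
  then show ?thesis by (simp add: t_def)
qed

text \<open>
  As \<open>p\<close> is odd, \<open>k \<mapsto> p - k\<close> exchanges the odd and the even numbers in \<open>{1..p-1}\<close>.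
\<close>
lemma sum_symmetric_eq_sum_odd:
  fixes g :: "int \<Rightarrow> real"
  assumes p: "p = 2 * L + 1" and sym: "\<And>k. g (int p - k) = g k"
  shows "(\<Sum>k\<in>{1..<int p}. g k) = 2 * (\<Sum>j<L. g (2 * int j + 1))"
proof -
  have "(\<Sum>k\<in>{1..<int p}. g k) = (\<Sum>k<2 * L. g (int k + 1))"
    by (rule sum.reindex_bij_witness[of _ "\<lambda>k. int k + 1" "\<lambda>k. nat (k - 1)"]) (auto simp: p)
  also have "\<dots> = (\<Sum>j<L. g (2 * int j + 1)) + (\<Sum>j<L. g (2 * int j + 2))"
    by (induction L) (simp_all add: algebra_simps)
  also have "(\<Sum>j<L. g (2 * int j + 2)) = (\<Sum>j<L. g (2 * int (L - Suc j) + 2))"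
    by (rule sum.nat_diff_reindex[symmetric])
  also have "\<dots> = (\<Sum>j<L. g (2 * int j + 1))"
  proof (rule sum.cong[OF refl])
    fix j assume "j \<in> {..<L}"
    then have "2 * int (L - Suc j) + 2 = int p - (2 * int j + 1)"
      by (simp add: p of_nat_diff)
    then show "g (2 * int (L - Suc j) + 2) = g (2 * int j + 1)" by (simp only: sym)
  qed
  finally show ?thesis by simp
qed

lemma sum_norm_exp_sum_upper_half_le:
  assumes p: "p = 2 * L + 1" and "L > 0"
  shows "(\<Sum>k\<in>{1..<int p}. norm (exp_sum p (\<lambda>h. h) {int L + 1..<int p} k)) \<le> real p * (4 / pi\<^sup>2 * ln (3 * real p))"
proof -
  let ?g = "\<lambda>k. norm (exp_sum p (\<lambda>h. h) {int L + 1..<int p} k)"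
  have "?g (int p - k) = ?g k" for k
  proof -
    have "?g (int p - k) = ?g (- k)"
      using p by (subst exp_sum_cong_freq[of p "int p - k" "- k"]) (auto simp: Cong.cong_def)
    then show ?thesis by (simp add: norm_exp_sum_uminus)
  qed
  then have "(\<Sum>k\<in>{1..<int p}. ?g k) = 2 * (\<Sum>j<L. ?g (2 * int j + 1))"
    by (rule sum_symmetric_eq_sum_odd[OF p])
  also have "(\<Sum>j<L. ?g (2 * int j + 1)) = (\<Sum>j<L. 1 / (2 * sin (pi * (2 * real j + 1) / (2 * real p))))"
    by (intro sum.cong refl norm_exp_sum_upper_half_odd[OF p refl]) auto
  also have "2 * \<dots> = (\<Sum>j<L. 1 / sin (pi * (2 * real j + 1) / (2 * real p)))"
    by (simp add: sum_distrib_left)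
  also have "\<dots> \<le> real p * (4 / pi\<^sup>2 * ln (3 * real p))"
    by (rule sum_inverse_sin_odd_le[OF assms])
  finally show ?thesis .
qed

section \<open>Counting powers in the upper half\<close>

text \<open>
  The sum \<open>S\<close> runs over \<open>x \<noteq> 0\<close> only. This costs the \<open>+ 1\<close> in the error term, and it makes
  the contribution of frequency \<open>0\<close> equal to \<open>(p-1)\<^sup>2/2\<close>.
\<close>
lemma card_powers_in_upper_half_approx:
  assumes "prime p" and p: "p = 2 * L + 1" and "d > 0"
  shows "\<bar>real (card {x \<in> {1..<int p}. x ^ d mod int p > int L}) - (real p - 1)\<^sup>2 / (2 * real p)\<bar>
          \<le> 4 / pi\<^sup>2 * ((real d - 1) * sqrt (real p) + 1) * ln (3 * real p)"
proof -
  define H X where "H = {int L + 1..<int p}" and "X = {1..<int p}"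
  define N where "N = card {x \<in> X. x ^ d mod int p > int L}"
  define S where "S = exp_sum p (\<lambda>x. x ^ d) X"
  define E where "E = (\<Sum>k\<in>{1..<int p}. S k * cnj (exp_sum p (\<lambda>h. h) H k))"
  have pos: "p > 0" "L > 0" using assms prime_gt_1_nat[of p] by auto
  have fin: "finite H" "finite X" by (simp_all add: H_def X_def)
  have split: "{0..<int p} = insert 0 {1..<int p}" using p by auto
  have "bij_betw fst {(x, h) \<in> X \<times> H. [x ^ d = h] (mod int p)} {x \<in> X. x ^ d mod int p > int L}"
    by (rule bij_betw_byWitness[of _ "\<lambda>x. (x, x ^ d mod int p)"])
       (use pos in \<open>auto simp: H_def Cong.cong_def\<close>)
  then have N: "card {(x, h) \<in> X \<times> H. [x ^ d = h] (mod int p)} = N"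
    unfolding N_def by (rule bij_betw_same_card)
  have cards: "card X = 2 * L" "card H = L" by (simp_all add: X_def H_def p)
  have "of_nat (2 * L * L) + E = complex_of_nat (p * N)"
    using sum_exp_sum_times_cnj[OF pos(1) fin(2,1), of "\<lambda>x. x ^ d" "\<lambda>h. h", unfolded N]
    by (simp add: split E_def S_def exp_sum_0 cards del: of_nat_mult) (simp add: mult_ac)
  then have "E = complex_of_real (real p * real N - real (2 * L * L))"
    by (simp add: algebra_simps)
  then have "\<bar>real p * real N - real (2 * L * L)\<bar> = norm E"
    by (simp only: norm_of_real)
  also have "\<dots> \<le> (\<Sum>k\<in>{1..<int p}. norm (S k) * norm (exp_sum p (\<lambda>h. h) H k))"
    unfolding E_def by (rule order_trans[OF norm_sum]) (simp add: norm_mult)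
  also have "\<dots> \<le> (\<Sum>k\<in>{1..<int p}. ((real d - 1) * sqrt (real p) + 1) * norm (exp_sum p (\<lambda>h. h) H k))"
  proof (intro sum_mono mult_right_mono norm_ge_zero)
    fix k assume "k \<in> {1..<int p}"
    then have "\<not> int p dvd k" using zdvd_not_zless by auto
    then have "norm (exp_sum p (\<lambda>x. x ^ d) {0..<int p} k) \<le> (real d - 1) * sqrt (real p)"
      by (rule norm_power_sum_le[OF assms(1,3)])
    moreover have "S k = exp_sum p (\<lambda>x. x ^ d) {0..<int p} k - 1"
      using assms(3) by (simp add: S_def X_def exp_sum_def split zero_power)
    ultimately show "norm (S k) \<le> (real d - 1) * sqrt (real p) + 1"
      using norm_triangle_ineq4[of "exp_sum p (\<lambda>x. x ^ d) {0..<int p} k" 1] by simp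
  qed
  also have "\<dots> \<le> ((real d - 1) * sqrt (real p) + 1) * (real p * (4 / pi\<^sup>2 * ln (3 * real p)))"
    unfolding H_def sum_distrib_left[symmetric] using assms(3)
    by (intro mult_left_mono sum_norm_exp_sum_upper_half_le[OF p pos(2)] add_nonneg_nonneg mult_nonneg_nonneg) auto
  also have "\<bar>real p * real N - real (2 * L * L)\<bar> = real p * \<bar>real N - (real p - 1)\<^sup>2 / (2 * real p)\<bar>"
  proof -
    have "real (2 * L * L) = real p * ((real p - 1)\<^sup>2 / (2 * real p))"
      using pos p by (simp add: field_simps power2_eq_square)
    then show ?thesis using pos by (simp only: abs_mult flip: right_diff_distrib)
  qed
  finally have "real p * \<bar>real N - (real p - 1)\<^sup>2 / (2 * real p)\<bar>
      \<le> real p * (4 / pi\<^sup>2 * ((real d - 1) * sqrt (real p) + 1) * ln (3 * real p))"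
    by (simp only: mult_ac)
  then have "\<bar>real N - (real p - 1)\<^sup>2 / (2 * real p)\<bar>
      \<le> 4 / pi\<^sup>2 * ((real d - 1) * sqrt (real p) + 1) * ln (3 * real p)"
    by (rule mult_left_le_imp_le) (use pos in simp)
  then show ?thesis unfolding N_def X_def .
qed

text \<open>
  Multiplication by \<open>\<omega>\<^sup>i\<close> maps the elements of \<open>A\<close> with property \<open>P\<close> bijectively onto those of
  the \<open>i\<close>-th translate, and the \<open>d\<close> translates partition \<open>{1..p-1}\<close>.
\<close>
lemma card_invariant_on_fundamental_domain:
  assumes "prime p" and w: "\<omega> \<in> Units (GFp p)" and A: "fundamental_domain p d \<omega> A"
    and inv: "\<And>i x. P (\<omega> ^ i * x mod int p) \<longleftrightarrow> P x"
  shows "card {x \<in> {1..<int p}. P x} = d * card {x \<in> A. P x}"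
proof -
  interpret residues_prime p "GFp p" by unfold_locales (fact assms(1))
  define T where "T i = (\<lambda>x. \<omega> ^ i * x mod int p) ` A" for i
  have w_range: "0 < \<omega>" "\<omega> < int p" using w res_prime_units_eq by auto
  have "\<omega> [^]\<^bsub>GFp p\<^esub> i = \<omega> ^ i mod int p" for i :: nat
    using pow_cong[of \<omega> i] w_range by simp
  then have coset: "(\<omega> [^]\<^bsub>GFp p\<^esub> i) <#\<^bsub>GFp p\<^esub> A = T i" for i
    by (auto simp: l_coset_def T_def res_mult_eq mod_mult_left_eq)
  have A_range: "A \<subseteq> {1..<int p}" using A by (auto simp: fundamental_domain_def)
  then have fin: "finite A" by (rule finite_subset) simp
  have units: "Units (GFp p) = {1..<int p}" using res_prime_units_eq by auto
  have cover: "{1..<int p} = (\<Union>i<d. T i)"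
    using A by (simp add: fundamental_domain_def coset units)
  have disj: "disjoint_family_on T {..<d}"
    using A by (simp add: fundamental_domain_def coset)
  have card_T: "card {x \<in> T i. P x} = card {x \<in> A. P x}" for i
  proof -
    have "\<not> int p dvd \<omega>" using w_range zdvd_not_zless by blast
    then have "\<not> int p dvd \<omega> ^ i" using assms(1) by (auto dest: prime_dvd_power[rotated])
    then have "inj_on (\<lambda>x. \<omega> ^ i * x mod int p) {0..<int p}"
      using bij_betw_mult_mod_prime[OF assms(1)] bij_betw_imp_inj_on by blast
    then have "inj_on (\<lambda>x. \<omega> ^ i * x mod int p) {x \<in> A. P x}"
      by (rule inj_on_subset) (use A_range in auto)
    moreover have "{x \<in> T i. P x} = (\<lambda>x. \<omega> ^ i * x mod int p) ` {x \<in> A. P x}"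
      using inv by (auto simp: T_def)
    ultimately show ?thesis by (simp add: card_image)
  qed
  have "{x \<in> {1..<int p}. P x} = (\<Union>i<d. {x \<in> T i. P x})"
    unfolding cover by auto
  also have "card \<dots> = (\<Sum>i<d. card {x \<in> T i. P x})"
    using disj fin by (intro card_UN_disjoint) (auto simp: disjoint_family_on_def T_def)
  finally show ?thesis by (simp add: card_T)
qed

lemma frac_of_int_divide: "n > 0 \<Longrightarrow> frac (real_of_int a / real n) = real_of_int (a mod int n) / real n"
proof -
  assume n: "n > 0"
  have "\<lfloor>real_of_int a / real n\<rfloor> = a div int n"
    using floor_divide_of_int_eq[of a "int n"] by simp
  moreover have "real_of_int a = real_of_int (a div int n) * real n + real_of_int (a mod int n)"
    by (metis div_mult_mod_eq of_int_add of_int_mult of_int_of_nat_eq)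
  ultimately show ?thesis using n by (simp add: frac_def field_simps)
qed

text \<open>
  As \<open>p = 2L+1\<close> is odd, \<open>{x\<^sup>d/p} > 1/2\<close> says that the residue of \<open>x\<^sup>d\<close> exceeds \<open>L\<close>. This
  property is invariant under \<open>x \<mapsto> \<omega> x\<close>, so the estimate over all of \<open>{1..p-1}\<close> can be divided
  by \<open>d\<close>.
\<close>
theorem upper_half_count_approx:
  assumes d: "d \<ge> 2" and p: "prime p" "[p = 1] (mod d)"
    and w: "\<omega> \<in> Units (GFp p)" "primitive_root_of_unity (GFp p) d \<omega>"
    and A: "fundamental_domain p d \<omega> A"
  shows "p \<ge> 3"
    and "\<bar>real (upper_half_count d A p) - (real p - 1)\<^sup>2 / (2 * real d * real p)\<bar>
              \<le> 4 / (real d * pi\<^sup>2) * ((real d - 1) * sqrt (real p) + 1) * ln (3 * real p)"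
proof -
  interpret residues_prime p "GFp p" by unfold_locales (fact p(1))
  have "d dvd p - 1"
    using p prime_gt_1_nat[of p] by (simp add: cong_altdef_nat)
  then have "d \<le> p - 1" using prime_gt_1_nat[OF p(1)] by (intro dvd_imp_le) auto
  then show p3: "p \<ge> 3" using d by simp
  then have "odd p" using prime_odd_nat p by simp
  then obtain L where L: "p = 2 * L + 1" by (auto elim: oddE)
  define P where "P x \<longleftrightarrow> x ^ d mod int p > int L" for x
  have "\<omega> mod int p = \<omega>" using w(1) res_prime_units_eq by auto
  then have w_d: "[\<omega> ^ d = 1] (mod int p)"
    using w(2) pow_cong[of \<omega> d] mod_pos_pos_trivial[of 1 "int p"] p3
    by (simp add: primitive_root_of_unity_def res_one_eq Cong.cong_def)
  have inv: "P (\<omega> ^ i * x mod int p) \<longleftrightarrow> P x" for i x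
  proof -
    have "[(\<omega> ^ i * x) ^ d = (\<omega> ^ d) ^ i * x ^ d] (mod int p)"
      by (simp add: power_mult_distrib mult.commute flip: power_mult)
    also have "[(\<omega> ^ d) ^ i * x ^ d = 1 ^ i * x ^ d] (mod int p)"
      by (intro cong_mult cong_pow w_d cong_refl)
    finally show ?thesis by (simp add: P_def Cong.cong_def power_mod)
  qed
  have half: "frac (real_of_int (x ^ d) / real p) > 1 / 2 \<longleftrightarrow> P x" for x
  proof -
    have "frac (real_of_int (x ^ d) / real p) > 1 / 2 \<longleftrightarrow> 2 * real_of_int (x ^ d mod int p) > real_of_int (int p)"
      using p3 by (subst frac_of_int_divide) (auto simp: field_simps)
    also have "\<dots> \<longleftrightarrow> P x" unfolding P_def L by linarith
    finally show ?thesis .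
  qed
  have count: "real (card {x \<in> {1..<int p}. P x}) = real d * real (upper_half_count d A p)"
    using card_invariant_on_fundamental_domain[OF p(1) w(1) A, of P] inv
    by (simp only: upper_half_count_def half of_nat_mult)
  have "\<bar>real d * real (upper_half_count d A p) - (real p - 1)\<^sup>2 / (2 * real p)\<bar>
          \<le> 4 / pi\<^sup>2 * ((real d - 1) * sqrt (real p) + 1) * ln (3 * real p)"
    using card_powers_in_upper_half_approx[OF p(1) L, of d] d unfolding P_def[symmetric] count by simp
  also have "real d * real (upper_half_count d A p) - (real p - 1)\<^sup>2 / (2 * real p)
           = real d * (real (upper_half_count d A p) - (real p - 1)\<^sup>2 / (2 * real d * real p))"
    using d by (simp add: right_diff_distrib)
  also have "\<bar>\<dots>\<bar> = real d * \<bar>real (upper_half_count d A p) - (real p - 1)\<^sup>2 / (2 * real d * real p)\<bar>"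
    by (simp add: abs_mult)
  also have "4 / pi\<^sup>2 * ((real d - 1) * sqrt (real p) + 1) * ln (3 * real p)
           = real d * (4 / (real d * pi\<^sup>2) * ((real d - 1) * sqrt (real p) + 1) * ln (3 * real p))"
    using d by simp
  finally show "\<bar>real (upper_half_count d A p) - (real p - 1)\<^sup>2 / (2 * real d * real p)\<bar>
              \<le> 4 / (real d * pi\<^sup>2) * ((real d - 1) * sqrt (real p) + 1) * ln (3 * real p)"
    by (rule mult_left_le_imp_le) (use d in simp)
qed

text \<open>
  These two bounds turn the explicit estimate into the asymptotic one, with constant \<open>2\<close>: the
  error term is at most \<open>(8/\<pi>\<^sup>2) \<surd>p log p\<close> because \<open>log(3p) \<le> 2 log p\<close> for \<open>p \<ge> 3\<close>, and the
  two main terms differ by less than \<open>1/d\<close>.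
\<close>
lemma error_terms_le:
  assumes "d \<ge> 2" "p \<ge> (3::nat)"
  shows "4 / (real d * pi\<^sup>2) * ((real d - 1) * sqrt (real p) + 1) * ln (3 * real p)
           \<le> sqrt (real p) * ln (real p)"
    and "\<bar>(real p - 1)\<^sup>2 / (2 * real d * real p) - real p / (2 * real d)\<bar> \<le> sqrt (real p) * ln (real p)"
proof -
  have p: "real p \<ge> 3" and d: "real d \<ge> 2" using assms by auto
  have "exp 1 \<le> real p" using exp_le p by linarith
  then have ln1: "1 \<le> ln (real p)" using p by (simp add: ln_ge_iff)
  have sqrt1: "1 \<le> sqrt (real p)" using p by simp
  have "3\<^sup>2 \<le> pi\<^sup>2" using pi_gt3 by (intro power_mono) auto
  then have pi: "8 \<le> pi\<^sup>2" by simp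
  have "ln (3 * real p) \<le> ln (real p * real p)" using p by simp
  also have "\<dots> = 2 * ln (real p)" using p by (simp add: ln_mult)
  finally have ln3: "ln (3 * real p) \<le> 2 * ln (real p)" .
  have "(real d - 1) * sqrt (real p) + 1 \<le> real d * sqrt (real p)"
    using sqrt1 by (simp add: algebra_simps)
  then have "4 / (real d * pi\<^sup>2) * ((real d - 1) * sqrt (real p) + 1) * ln (3 * real p)
     \<le> 4 / (real d * pi\<^sup>2) * (real d * sqrt (real p)) * (2 * ln (real p))"
    using d p ln3 by (intro mult_mono) auto
  also have "\<dots> = 8 / pi\<^sup>2 * (sqrt (real p) * ln (real p))" using d by simp
  also have "\<dots> \<le> 1 * (sqrt (real p) * ln (real p))"
    using pi ln1 sqrt1 by (intro mult_right_mono) auto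
  finally show "4 / (real d * pi\<^sup>2) * ((real d - 1) * sqrt (real p) + 1) * ln (3 * real p)
           \<le> sqrt (real p) * ln (real p)" by simp
  have small: "0 \<le> 1 / real d" "1 / real d \<le> 1" "0 \<le> 1 - 1 / (2 * real p)" "1 - 1 / (2 * real p) \<le> 1"
    using d p by (auto simp: divide_le_eq)
  have "(1 / real d) * (1 - 1 / (2 * real p)) \<le> 1 * 1"
    by (rule mult_mono[OF small(2,4) _ small(3)]) simp
  moreover have "0 \<le> (1 / real d) * (1 - 1 / (2 * real p))"
    by (rule mult_nonneg_nonneg[OF small(1,3)])
  moreover have "(real p - 1)\<^sup>2 / (2 * real d * real p) - real p / (2 * real d)
      = - ((1 / real d) * (1 - 1 / (2 * real p)))"
    using d p by (simp add: field_simps power2_eq_square)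
  moreover have "1 * 1 \<le> sqrt (real p) * ln (real p)" using ln1 sqrt1 by (intro mult_mono) auto
  ultimately show "\<bar>(real p - 1)\<^sup>2 / (2 * real d * real p) - real p / (2 * real d)\<bar> \<le> sqrt (real p) * ln (real p)"
    by linarith
qed

theorem theorem1p8:
  fixes d :: nat
  assumes "d \<ge> 2"
  shows "(\<forall>(p::nat) (\<omega>::int) (A::int set).
            prime p \<and> [p = 1] (mod d) \<and>
            \<omega> \<in> Units (GFp p) \<and> primitive_root_of_unity (GFp p) d \<omega> \<and>
            fundamental_domain p d \<omega> A \<longrightarrow>
            \<bar>real (upper_half_count d A p) - (real p - 1)\<^sup>2 / (2 * real d * real p)\<bar>
              \<le> 4 / (real d * pi\<^sup>2) * ((real d - 1) * sqrt (real p) + 1) * ln (3 * real p))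
       \<and> (\<exists>c::real. c > 0 \<and>
            (\<forall>(p::nat) (\<omega>::int) (A::int set).
              prime p \<and> [p = 1] (mod d) \<and>
              \<omega> \<in> Units (GFp p) \<and> primitive_root_of_unity (GFp p) d \<omega> \<and>
              fundamental_domain p d \<omega> A \<longrightarrow>
              \<bar>real (upper_half_count d A p) - real p / (2 * real d)\<bar>
                \<le> c * (sqrt (real p) * ln (real p))))"
proof (intro conjI exI[of _ "2::real"] allI impI; (elim conjE)?)
  fix p \<omega> A
  assume h: "prime p" "[p = 1] (mod d)" "\<omega> \<in> Units (GFp p)"
    "primitive_root_of_unity (GFp p) d \<omega>" "fundamental_domain p d \<omega> A"
  note explicit = upper_half_count_approx[OF assms h]
  show "\<bar>real (upper_half_count d A p) - (real p - 1)\<^sup>2 / (2 * real d * real p)\<bar>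
          \<le> 4 / (real d * pi\<^sup>2) * ((real d - 1) * sqrt (real p) + 1) * ln (3 * real p)"
    by (rule explicit(2))
  show "\<bar>real (upper_half_count d A p) - real p / (2 * real d)\<bar> \<le> 2 * (sqrt (real p) * ln (real p))"
    using explicit(2) error_terms_le[OF assms explicit(1)] by linarith
qed simp

end
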